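(* Let $N\ge 0$ be an integer. The only Markov kernel $\Lambda\in\mathcal{K}_N$ satisfying the intertwining relation $$L_N\Lambda=\Lambda L\qquad\text{(as operators on polynomial functions)}$$ is the trivial kernel given by $\Lambda(n,\cdot)=\gamma$ for all $n\in\{0,\dots,N\}$.
   Context: For an integer $N\ge 0$, the Ehrenfest generator $L_N$ is the $\{0,\dots,N\}\times\{0,\dots,N\}$ matrix whose off-diagonal entries are $L_N(x,x+1)=\frac{N-x}{2}$, $L_N(x,x-1)=\frac{x}{2}$, and $L_N(x,x')=0$ for $|x-x'|\ge 2$, and whose diagonal entries are such that all row sums vanish. The Ornstein-Uhlenbeck operator $L$ acts on the space $\mathcal{P}$ of polynomial functions on $\mathbb{R}$ by $L[f](x)=f''(x)-xf'(x)$. $\gamma$ is the standard normal distribution on $\mathbb{R}$. $\mathcal{M}$ is the set of probability measures on $\mathbb{R}$ integrating $x\mapsto\exp(x^2/4)$, and $\mathcal{K}_N$ is the set of Markov kernels $\Lambda$ from $\{0,\dots,N\}$ to $\mathbb{R}$ (i.e. families of Borel probability measures $\Lambda(n,\cdot)$ on $\mathbb{R}$) such that $\Lambda(n,\cdot)\in\mathcal{M}$ for all $n\in\{0,\dots,N\}$. With $\Lambda[f](n)=\int f(x)\,\Lambda(n,dx)$, the relation $L_N\Lambda=\Lambda L$ means $L_N[\Lambda[f]]=\Lambda[L[f]]$ for all $f\in\mathcal{P}$. *)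

theory Defs
  imports "HOL-Probability.Probability"
begin

definition ehrenfest_rate :: "nat \<Rightarrow> nat \<Rightarrow> nat \<Rightarrow> real" where
  "ehrenfest_rate N x y =
     (if y = x + 1 then (real N - real x) / 2
      else if x = y + 1 then real x / 2
      else 0)"

text \<open>Matrix indices range over \<open>{0..N}\<close>; entries outside this range are never used.\<close>

definition ehrenfest_generator :: "nat \<Rightarrow> nat \<Rightarrow> nat \<Rightarrow> real" where
  "ehrenfest_generator N x y =
     (if x = y then - (\<Sum>z\<in>{0..N} - {x}. ehrenfest_rate N x z)
      else ehrenfest_rate N x y)"

definition ehrenfest_op :: "nat \<Rightarrow> (nat \<Rightarrow> real) \<Rightarrow> nat \<Rightarrow> real" where
  "ehrenfest_op N g x = (\<Sum>y\<in>{0..N}. ehrenfest_generator N x y * g y)"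

definition polynomial_functions :: "(real \<Rightarrow> real) set" where
  "polynomial_functions = {f. real_polynomial_function f}"

definition ornstein_uhlenbeck :: "(real \<Rightarrow> real) \<Rightarrow> real \<Rightarrow> real" where
  "ornstein_uhlenbeck f x = deriv (deriv f) x - x * deriv f x"

definition gauss_integrating_measures :: "real measure set" where
  "gauss_integrating_measures =
     {\<mu>. real_distribution \<mu> \<and> integrable \<mu> (\<lambda>x. exp (x\<^sup>2 / 4))}"

definition markov_kernels :: "nat \<Rightarrow> (nat \<Rightarrow> real measure) set" where
  "markov_kernels N =
     {\<Lambda> \<in> count_space {0..N} \<rightarrow>\<^sub>M prob_algebra borel.
        \<forall>n\<in>{0..N}. \<Lambda> n \<in> gauss_integrating_measures}"

text \<open>Polynomials are integrable with respect to every element of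
  \<open>gauss_integrating_measures\<close>, so for the kernels considered here the
  convention that the integral of a non-integrable function is zero plays no role.\<close>

definition kernel_op :: "(nat \<Rightarrow> real measure) \<Rightarrow> (real \<Rightarrow> real) \<Rightarrow> nat \<Rightarrow> real" where
  "kernel_op \<Lambda> f n = (\<integral>x. f x \<partial>\<Lambda> n)"

definition intertwining :: "nat \<Rightarrow> (nat \<Rightarrow> real measure) \<Rightarrow> bool" where
  "intertwining N \<Lambda> \<longleftrightarrow>
     (\<forall>f\<in>polynomial_functions. \<forall>n\<in>{0..N}.
        ehrenfest_op N (kernel_op \<Lambda> f) n = kernel_op \<Lambda> (ornstein_uhlenbeck f) n)"

end

theory Submission
  imports Defs "HOL-Analysis.FPS_Convergence"
begin

text \<open>
  On exponential generating functions of moments, the Ornstein-Uhlenbeck operator acts as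
  \<open>M \<mapsto> t\<^sup>2 M - t M'\<close>, and the moment series \<open>A\<close> of the Gaussian satisfies \<open>A' = t A\<close>. Hence
  the quotients \<open>G\<^sub>n = M\<^sub>n / A\<close>, whose coefficients are the normalised Hermite moments of
  \<open>\<Lambda>(n, \<cdot>)\<close>, satisfy \<open>L\<^sub>N G = - t G'\<close>: the \<open>k\<close>-th coefficient is an eigenfunction of \<open>L\<^sub>N\<close>
  for the eigenvalue \<open>-k\<close>. It vanishes for \<open>k > N\<close>, so each \<open>G\<^sub>n\<close> is a polynomial. Let
  \<open>k \<ge> 1\<close> be maximal such that the \<open>k\<close>-th coefficient is not zero for every \<open>n\<close>. As an eigenfunction
  for a nonzero eigenvalue it has mean zero under the binomial distribution, so it is negative for
  some \<open>n\<close>; then \<open>G\<^sub>n(t) \<rightarrow> -\<infinity>\<close> as \<open>t \<rightarrow> \<infinity>\<close>, although \<open>A(t) G\<^sub>n(t)\<close> is the integral of the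
  positive function \<open>exp(t x)\<close>. So \<open>G\<^sub>n = 1\<close>, and \<open>\<Lambda>(n, \<cdot>)\<close> has the moments of the Gaussian,
  which determine it because the characteristic function is the sum of its moment series.
\<close>

unbundle no vec_syntax and fps_syntax

section \<open>The spectrum of the Ehrenfest generator\<close>

text \<open>At \<open>x = N\<close> and \<open>x = 0\<close> the corresponding rate vanishes, so the
  out-of-range value \<open>g (N + 1)\<close> and the truncated \<open>0 - 1\<close> are
  harmless.\<close>

lemma ehrenfest_op_eq:
  assumes "x \<le> N"
  shows "ehrenfest_op N g x =
    (real N - real x) / 2 * (g (x + 1) - g x) + real x / 2 * (g (x - 1) - g x)"
proof -
  have rate: "(\<Sum>z\<in>{0..N} - {x}. ehrenfest_rate N x z * h z) =
      (real N - real x) / 2 * h (x + 1) + real x / 2 * h (x - 1)" for h :: "nat \<Rightarrow> real"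
  proof -
    have "(\<Sum>z\<in>{0..N} - {x}. ehrenfest_rate N x z * h z) =
        (\<Sum>z\<in>{0..N} - {x}. (if z = x + 1 then (real N - real x) / 2 * h (x + 1) else 0) +
           (if z = x - 1 then real x / 2 * h (x - 1) else 0))"
      by (rule sum.cong) (auto simp: ehrenfest_rate_def)
    also have "\<dots> = (real N - real x) / 2 * h (x + 1) + real x / 2 * h (x - 1)"
      using assms by (cases "x = N"; cases "x = 0") (auto simp: sum.distrib)
    finally show ?thesis .
  qed
  have "ehrenfest_op N g x = ehrenfest_generator N x x * g x +
      (\<Sum>z\<in>{0..N} - {x}. ehrenfest_generator N x z * g z)"
    unfolding ehrenfest_op_def using assms by (intro sum.remove) auto
  also have "(\<Sum>z\<in>{0..N} - {x}. ehrenfest_generator N x z * g z) =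
      (\<Sum>z\<in>{0..N} - {x}. ehrenfest_rate N x z * g z)"
    by (intro sum.cong) (auto simp: ehrenfest_generator_def)
  also have "ehrenfest_generator N x x = - ((real N - real x) / 2 + real x / 2)"
    using rate[of "\<lambda>_. 1"] by (simp add: ehrenfest_generator_def)
  finally show ?thesis
    unfolding rate by (simp add: algebra_simps add_divide_distrib diff_divide_distrib)
qed

lemma ehrenfest_op_sum:
  "ehrenfest_op N (\<lambda>n. \<Sum>i\<in>I. c i * g i n) x = (\<Sum>i\<in>I. c i * ehrenfest_op N (g i) x)"
  unfolding ehrenfest_op_def sum_distrib_left
  by (subst sum.swap) (simp add: mult_ac)

lemma ehrenfest_op_const:
  assumes "x \<le> N" "\<And>n. n \<le> N \<Longrightarrow> g n = c"
  shows "ehrenfest_op N g x = 0"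
proof -
  have "ehrenfest_op N g x = ehrenfest_op N (\<lambda>_. c) x"
    unfolding ehrenfest_op_def using assms by (intro sum.cong) auto
  also have "\<dots> = 0"
    using assms by (simp add: ehrenfest_op_eq)
  finally show ?thesis .
qed

section \<open>Eigenfunctions through their binomial generating polynomials\<close>

definition binomial_poly :: "nat \<Rightarrow> (nat \<Rightarrow> real) \<Rightarrow> real poly" where
  "binomial_poly N g = (\<Sum>n\<le>N. monom (real (N choose n) * g n) n)"

lemma coeff_binomial_poly: "coeff (binomial_poly N g) n = real (N choose n) * g n"
  by (simp add: binomial_poly_def coeff_sum binomial_eq_0)

lemma poly_binomial_poly_1: "poly (binomial_poly N g) 1 = (\<Sum>n\<le>N. real (N choose n) * g n)"
  by (simp add: binomial_poly_def poly_sum poly_monom)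

text \<open>By detailed balance, the weights \<open>N choose n\<close> turn \<open>L\<^sub>N\<close> into its transpose, which acts on
  generating polynomials as a first-order differential operator.\<close>

lemma binomial_poly_ode:
  assumes eig: "\<forall>n\<le>N. ehrenfest_op N g n = c * g n"
  defines "p \<equiv> binomial_poly N g"
  shows "[:1, 1:] * [:1, -1:] * pderiv p = smult (real N) ([:1, -1:] * p) + smult (2 * c) p"
proof (rule poly_eqI)
  fix n
  \<comment> \<open>Detailed balance of the weights; from \<open>n = N\<close> on both sides vanish,
    so it holds for every \<open>n\<close>.\<close>
  have up: "real (Suc n) * real (N choose Suc n) = (real N - real n) * real (N choose n)" for n
  proof (cases "n \<le> N")
    case True
    then show ?thesis
      using binomial_absorb_comp[of N n] binomial_absorption[of n N]
      by (metis Suc_eq_plus1 binomial_absorb_comp binomial_absorption of_nat_diff of_nat_mult)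
  qed (auto simp: binomial_eq_0)
  have eig': "real (N choose n) * ((real N - real n) * (g (Suc n) - g n) + real n * (g (n - 1) - g n))
      = 2 * c * (real (N choose n) * g n)" for n
  proof (cases "n \<le> N")
    case True
    have "(real N - real n) * (g (Suc n) - g n) + real n * (g (n - 1) - g n) = 2 * c * g n"
      using eig True ehrenfest_op_eq[OF True, of g] by (auto simp: field_simps)
    then show ?thesis by (metis mult.left_commute)
  qed (auto simp: binomial_eq_0)
  have q: "[:1, 1:] * [:1, -1:] = ([:1, 0, -1:] :: real poly)" by simp
  show "coeff ([:1, 1:] * [:1, -1:] * pderiv p) n =
      coeff (smult (real N) ([:1, -1:] * p) + smult (2 * c) p) n"
  proof (cases n)
    case 0
    then show ?thesis
      using eig'[of 0] up[of 0]
      unfolding q by (simp add: p_def coeff_pderiv coeff_binomial_poly algebra_simps coeff_pCons)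
  next
    case (Suc m)
    let ?b = "\<lambda>n. real (N choose n)"
    \<comment> \<open>\<open>up\<close> turns the weight \<open>?b (Suc m)\<close> in front of
      \<open>g (Suc (Suc m))\<close> and \<open>g m\<close> into the weights of their own
      indices.\<close>
    have "real (Suc (Suc m)) * ?b (Suc (Suc m)) * g (Suc (Suc m)) - real m * ?b m * g m =
        real N * (?b (Suc m) * g (Suc m) - ?b m * g m) + 2 * c * (?b (Suc m) * g (Suc m))"
      using eig'[of "Suc m"] up[of "Suc m"] up[of m]
      unfolding diff_Suc_1 of_nat_Suc by algebra
    then show ?thesis
      using Suc unfolding q
      by (cases m) (simp_all add: p_def coeff_pderiv coeff_binomial_poly algebra_simps)
  qed
qed

text \<open>At 1 the factor \<open>[:1, -1:]\<close> kills every term of the differential equation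
  except \<open>2 * c\<close> times the weighted sum.\<close>

lemma ehrenfest_eigenfunction_balanced:
  assumes "\<forall>n\<le>N. ehrenfest_op N g n = c * g n" "c \<noteq> 0"
  shows "(\<Sum>n\<le>N. real (N choose n) * g n) = 0"
  using arg_cong[OF binomial_poly_ode[OF assms(1)], of "\<lambda>p. poly p 1"] assms(2)
  by (simp add: poly_binomial_poly_1)

text \<open>All binomial weights are positive, so a nonzero function with weighted sum zero must
  change sign.\<close>

lemma ehrenfest_eigenfunction_neg:
  assumes eig: "\<forall>n\<le>N. ehrenfest_op N g n = c * g n" "c \<noteq> 0"
    and nz: "m \<le> N" "g m \<noteq> 0"
  obtains n where "n \<le> N" "g n < 0"
proof -
  have "\<exists>n\<le>N. g n < 0"
  proof (rule ccontr)
    assume "\<not> ?thesis"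
    then have "\<forall>n\<in>{..N}. real (N choose n) * g n = 0"
      using ehrenfest_eigenfunction_balanced[OF eig]
      by (subst (asm) sum_nonneg_eq_0_iff) auto
    with nz show False by auto
  qed
  then show ?thesis using that by blast
qed

text \<open>Comparing both sides of the differential equation at \<open>-1\<close> shows that \<open>-1\<close> is a root of
  multiplicity \<open>N - k\<close>.\<close>

lemma ehrenfest_eigenvalue_bound:
  assumes eig: "\<forall>n\<le>N. ehrenfest_op N g n = - real k * g n"
    and nz: "m \<le> N" "g m \<noteq> 0"
  shows "k \<le> N"
proof -
  define p where "p = binomial_poly N g"
  have "p \<noteq> 0"
    using nz coeff_binomial_poly[of N g m] by (auto simp: p_def)
  then obtain q where q: "p = [:1, 1:] ^ order (- 1) p * q" "\<not> [:1, 1:] dvd q"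
    using order_decomp[of p "-1"] by auto
  define l where "l = order (- 1) p"
  define u v :: "real poly" where "u = [:1, 1:]" and "v = [:1, -1:]"
  have p: "p = u ^ l * q"
    using q(1) by (simp add: u_def l_def)
  have "pderiv u = 1" by (simp add: u_def pderiv_pCons)
  \<comment> \<open>The factor \<open>u\<close> restores the power lost by differentiation, so
    \<open>u ^ l\<close> can be cancelled from the whole equation.\<close>
  then have "u * pderiv (u ^ l) = smult (real l) (u ^ l)"
    by (cases l) (simp_all add: pderiv_power_Suc del: power_Suc, simp_all)
  then have "u * pderiv p = u ^ l * (u * pderiv q) + smult (real l) (u ^ l) * q"
    unfolding p pderiv_mult distrib_left
    by (simp add: mult.left_commute[of u] mult.commute[of q "u ^ l"])
  then have dp: "u * pderiv p = u ^ l * (smult (real l) q + u * pderiv q)"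
    by (simp add: algebra_simps)
  have "u ^ l * (v * (smult (real l) q + u * pderiv q)) = u * v * pderiv p"
    using dp by (metis mult.assoc mult.left_commute)
  also have "\<dots> = smult (real N) (v * p) + smult (2 * - real k) p"
    unfolding u_def v_def p_def by (rule binomial_poly_ode[OF eig])
  also have "\<dots> = u ^ l * (smult (real N) (v * q) + smult (2 * - real k) q)"
    unfolding p by (simp add: algebra_simps)
  finally have "v * (smult (real l) q + u * pderiv q) =
      smult (real N) (v * q) + smult (2 * - real k) q"
    by (subst (asm) mult_left_cancel) (auto simp: u_def)
  \<comment> \<open>At \<open>-1\<close>, \<open>u\<close> vanishes and \<open>v\<close> equals 2;
    as \<open>q\<close> does not vanish there, \<open>l = N - k\<close>.\<close>
  from arg_cong[OF this, of "\<lambda>p. poly p (-1)"]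
  have "2 * real l * poly q (-1) = 2 * (real N - real k) * poly q (-1)"
    by (simp add: u_def v_def algebra_simps)
  moreover have "poly q (-1) \<noteq> 0"
    using q(2) by (simp add: poly_eq_0_iff_dvd)
  ultimately show ?thesis by auto
qed

section \<open>Exponential moments\<close>

text \<open>Completing the square: the weight \<open>exp (x^2 / 4)\<close> dominates exponentials of
  every rate.\<close>

lemma exp_abs_mult_le: "exp (\<bar>r\<bar> * \<bar>x\<bar>) \<le> exp (r\<^sup>2) * exp (x\<^sup>2 / 4 :: real)"
proof -
  have "0 \<le> (\<bar>x\<bar> / 2 - \<bar>r\<bar>)\<^sup>2" by simp
  then show ?thesis
    by (simp add: power2_diff flip: exp_add) (simp add: field_simps power2_eq_square)
qed

lemma gauss_integrating_exp_abs:
  assumes "\<mu> \<in> gauss_integrating_measures"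
  shows "integrable \<mu> (\<lambda>x. exp (\<bar>r\<bar> * \<bar>x\<bar>))"
proof -
  interpret real_distribution \<mu>
    using assms by (simp add: gauss_integrating_measures_def)
  show ?thesis
    by (rule Bochner_Integration.integrable_bound[where f = "\<lambda>x. exp (r\<^sup>2) * exp (x\<^sup>2 / 4)"])
      (use assms in \<open>auto simp: gauss_integrating_measures_def exp_abs_mult_le\<close>)
qed

lemma gauss_integrating_moment:
  assumes "\<mu> \<in> gauss_integrating_measures"
  shows "integrable \<mu> (\<lambda>x. x ^ j)"
proof -
  interpret real_distribution \<mu>
    using assms by (simp add: gauss_integrating_measures_def)
  have le: "\<bar>x\<bar> ^ j \<le> fact j * exp (1 * \<bar>x\<bar>)" for x :: real
  proof -
    have "\<bar>x\<bar> ^ j /\<^sub>R fact j \<le> exp \<bar>x\<bar>"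
      using sum_le_suminf[of "\<lambda>j. \<bar>x\<bar> ^ j /\<^sub>R fact j" "{j}"]
      by (simp add: exp_def summable_exp)
    then show ?thesis by (simp add: field_simps)
  qed
  show ?thesis
    by (rule Bochner_Integration.integrable_bound[where f = "\<lambda>x. fact j * exp (\<bar>1\<bar> * \<bar>x\<bar>)"])
      (use gauss_integrating_exp_abs[OF assms, of 1] le in \<open>auto simp: power_abs\<close>)
qed

text \<open>Dominated convergence of the partial sums of the exponential series. The field is left
  general: real \<open>z\<close> gives the Laplace transform, imaginary \<open>z\<close> the
  characteristic function.\<close>

lemma gauss_integrating_mgf_sums:
  fixes z :: "'a :: {real_normed_field, banach, second_countable_topology}"
  assumes "\<mu> \<in> gauss_integrating_measures"
  shows "integrable \<mu> (\<lambda>x. exp (of_real x * z))"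
    and "(\<lambda>j. of_real ((\<integral>x. x ^ j \<partial>\<mu>) / fact j) * z ^ j) sums (\<integral>x. exp (of_real x * z) \<partial>\<mu>)"
proof -
  interpret real_distribution \<mu>
    using assms by (simp add: gauss_integrating_measures_def)
  define s where "s n x = (\<Sum>j<n. of_real (x ^ j) * (z ^ j / fact j))" for n and x :: real
  have lim: "(\<lambda>n. s n x) \<longlonglongrightarrow> exp (of_real x * z)" for x
  proof -
    have "(\<lambda>j. of_real (x ^ j) * (z ^ j / fact j)) sums exp (of_real x * z)"
      using exp_converges[of "of_real x * z"]
      by (simp add: scaleR_conv_of_real power_mult_distrib field_simps)
    then show ?thesis by (simp add: sums_def s_def)
  qed
  have bound: "norm (s n x) \<le> exp (\<bar>norm z\<bar> * \<bar>x\<bar>)" for n x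
  proof -
    have "norm (s n x) \<le> (\<Sum>j<n. (\<bar>norm z\<bar> * \<bar>x\<bar>) ^ j /\<^sub>R fact j)"
      unfolding s_def
      by (rule sum_norm_le)
        (simp add: norm_mult norm_divide norm_power power_mult_distrib power_abs field_simps)
    also have "\<dots> \<le> exp (\<bar>norm z\<bar> * \<bar>x\<bar>)"
      unfolding exp_def by (intro sum_le_suminf) (auto simp: summable_exp divide_inverse_commute)
    finally show ?thesis .
  qed
  have meas: "s n \<in> borel_measurable \<mu>" for n
    unfolding s_def[abs_def] by measurable
  have meas': "(\<lambda>x. exp (of_real x * z)) \<in> borel_measurable \<mu>"
    using meas lim by (rule borel_measurable_LIMSEQ_metric)
  note dom = gauss_integrating_exp_abs[OF assms, of "norm z"]
  show "integrable \<mu> (\<lambda>x. exp (of_real x * z))"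
    by (rule integrable_dominated_convergence[where s = s, OF meas' meas dom])
      (simp_all add: lim bound[simplified])
  have "(\<lambda>n. \<integral>x. s n x \<partial>\<mu>) \<longlonglongrightarrow> (\<integral>x. exp (of_real x * z) \<partial>\<mu>)"
    by (rule integral_dominated_convergence[where s = s, OF meas' meas dom])
      (simp_all add: lim bound[simplified])
  moreover have "(\<integral>x. s n x \<partial>\<mu>) = (\<Sum>j<n. of_real ((\<integral>x. x ^ j \<partial>\<mu>) / fact j) * z ^ j)" for n
    unfolding s_def
    using gauss_integrating_moment[OF assms]
    by (subst Bochner_Integration.integral_sum)
       (auto intro!: sum.cong integrable_mult_left integrable_of_real simp del: of_real_power)
  ultimately show "(\<lambda>j. of_real ((\<integral>x. x ^ j \<partial>\<mu>) / fact j) * z ^ j) sums (\<integral>x. exp (of_real x * z) \<partial>\<mu>)"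
    by (simp add: sums_def)
qed

lemma gauss_integrating_eqI:
  assumes \<mu>: "\<mu> \<in> gauss_integrating_measures" and \<nu>: "\<nu> \<in> gauss_integrating_measures"
    and eq: "\<And>j. (\<integral>x. x ^ j \<partial>\<mu>) = (\<integral>x. x ^ j \<partial>\<nu>)"
  shows "\<mu> = \<nu>"
proof (rule Levy_uniqueness)
  show "real_distribution \<mu>" "real_distribution \<nu>"
    using \<mu> \<nu> by (auto simp: gauss_integrating_measures_def)
  show "char \<mu> = char \<nu>"
  proof
    fix t
    have "(\<integral>x. exp (of_real x * (\<i> * of_real t)) \<partial>\<mu>) = (\<integral>x. exp (of_real x * (\<i> * of_real t)) \<partial>\<nu>)"
      using gauss_integrating_mgf_sums(2)[OF \<mu>, of "\<i> * of_real t"]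
        gauss_integrating_mgf_sums(2)[OF \<nu>, of "\<i> * of_real t"]
      unfolding eq by (rule sums_unique2)
    then show "char \<mu> t = char \<nu> t"
      by (simp add: char_def mult_ac)
  qed
qed

text \<open>A formal series, so that dividing by the Gaussian series raises no question of
  convergence.\<close>

definition mgf_fps :: "real measure \<Rightarrow> real fps" where
  "mgf_fps \<mu> = Abs_fps (\<lambda>j. (\<integral>x. x ^ j \<partial>\<mu>) / fact j)"

lemma mgf_fps_nth [simp]: "mgf_fps \<mu> $ j = (\<integral>x. x ^ j \<partial>\<mu>) / fact j"
  by (simp add: mgf_fps_def)

lemma eval_mgf_fps:
  assumes "\<mu> \<in> gauss_integrating_measures"
  shows "eval_fps (mgf_fps \<mu>) t = (\<integral>x. exp (x * t) \<partial>\<mu>)"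
  using gauss_integrating_mgf_sums(2)[OF assms, of t]
  by (simp add: eval_fps_def sums_iff)

text \<open>Allows products of these series to be evaluated factor by factor.\<close>

lemma fps_conv_radius_mgf_fps:
  assumes "\<mu> \<in> gauss_integrating_measures"
  shows "fps_conv_radius (mgf_fps \<mu>) = \<infinity>"
  unfolding fps_conv_radius_def
proof (rule conv_radius_inftyI'')
  fix z :: real
  show "summable (\<lambda>n. mgf_fps \<mu> $ n * z ^ n)"
    using gauss_integrating_mgf_sums(2)[OF assms, of z] by (simp add: sums_iff)
qed

section \<open>The Gaussian and the Ornstein-Uhlenbeck operator\<close>

text \<open>Up to the factor \<open>sqrt 2\<close>, the weighted density is the centred normal
  density of variance 2.\<close>

lemma std_normal_gauss_integrating: "std_normal_distribution \<in> gauss_integrating_measures"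
proof -
  have "std_normal_density x * exp (x\<^sup>2 / 4) = sqrt 2 * normal_density 0 (sqrt 2) x" for x
  proof -
    have "exp (- x\<^sup>2 / 2) * exp (x\<^sup>2 / 4) = exp (- x\<^sup>2 / 4)"
      by (simp flip: exp_add)
    then show ?thesis
      by (simp add: normal_density_def real_sqrt_mult field_simps)
  qed
  then have "integrable lborel (\<lambda>x. std_normal_density x * exp (x\<^sup>2 / 4))"
    by simp
  then have "integrable std_normal_distribution (\<lambda>x. exp (x\<^sup>2 / 4))"
    by (subst integrable_density) (auto simp: normal_density_nonneg)
  then show ?thesis
    by (simp add: gauss_integrating_measures_def real_dist_normal_dist)
qed

text \<open>For \<open>i < 2\<close> the coefficient \<open>i * (i - 1)\<close> is zero, which
  neutralises the truncated exponent \<open>i - 2\<close>.\<close>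

lemma ornstein_uhlenbeck_poly:
  "ornstein_uhlenbeck (\<lambda>x. \<Sum>i\<le>n. a i * x ^ i) x =
     (\<Sum>i\<le>n. a i * (real (i * (i - 1)) * x ^ (i - 2) - real i * x ^ i))"
proof -
  have d1: "deriv (\<lambda>x. \<Sum>i\<le>n. a i * x ^ i) = (\<lambda>x. \<Sum>i\<le>n. a i * (real i * x ^ (i - 1)))"
    by (rule ext, rule DERIV_imp_deriv) (auto intro!: derivative_eq_intros sum.cong)
  have d2: "deriv (\<lambda>x. \<Sum>i\<le>n. a i * (real i * x ^ (i - 1))) x =
      (\<Sum>i\<le>n. a i * (real i * (real (i - 1) * x ^ (i - 2))))" for x
    by (rule DERIV_imp_deriv) (auto intro!: derivative_eq_intros sum.cong simp: numeral_2_eq_2)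
  have "a i * (real i * (real (i - 1) * x ^ (i - 2))) - x * (a i * (real i * x ^ (i - 1))) =
      a i * (real (i * (i - 1)) * x ^ (i - 2) - real i * x ^ i)" for i
    by (cases i) (auto simp: algebra_simps)
  then show ?thesis
    unfolding ornstein_uhlenbeck_def d1 d2 sum_distrib_left by (simp only: flip: sum_subtractf)
qed

lemma integral_ornstein_uhlenbeck_poly:
  assumes "\<mu> \<in> gauss_integrating_measures"
  shows "(\<integral>x. ornstein_uhlenbeck (\<lambda>x. \<Sum>i\<le>n. a i * x ^ i) x \<partial>\<mu>) =
     (\<Sum>i\<le>n. a i * (real (i * (i - 1)) * (\<integral>x. x ^ (i - 2) \<partial>\<mu>) - real i * (\<integral>x. x ^ i \<partial>\<mu>)))"
  unfolding ornstein_uhlenbeck_poly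
  using gauss_integrating_moment[OF assms] by (simp add: Bochner_Integration.integral_sum)

text \<open>This is the invariance of the Gaussian: \<open>L[x^i]\<close> has integral zero.\<close>

lemma std_normal_moment_rec:
  "real (i * (i - 1)) * (\<integral>x. x ^ (i - 2) \<partial>std_normal_distribution) =
     real i * (\<integral>x. x ^ i \<partial>std_normal_distribution)"
proof (cases "even i \<and> i \<noteq> 0")
  case True
  then obtain k where k: "i = 2 * Suc k"
    by (metis dvdE mult_0_right not0_implies_Suc)
  have i: "i - 2 = 2 * k" using k by simp
  show ?thesis
    unfolding i unfolding k std_normal_distribution_even_moments
    by (simp add: divide_simps) (simp add: algebra_simps)
next
  case False
  \<comment> \<open>The case \<open>i = 1\<close> is separate because \<open>i - 2\<close> truncates
    to the even number 0.\<close>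
  then have "i = 0 \<or> i = 1 \<or> odd i \<and> odd (i - 2)"
    by (cases "i < 2") (auto simp: less_2_cases_iff)
  then show ?thesis
    by (elim disjE) (use integral_std_normal_distribution_moment_odd[of 1] in
        \<open>auto simp: integral_std_normal_distribution_moment_odd\<close>)
qed

text \<open>Since \<open>j * (j - 1) / fact j = 1 / fact (j - 2)\<close> for
  \<open>j \<ge> 2\<close>, lowering the moment by two becomes multiplication by \<open>t^2\<close>,
  and the factor \<open>j\<close> becomes \<open>t d/dt\<close>.\<close>

lemma mgf_fps_ornstein_uhlenbeck_nth:
  "(fps_X ^ 2 * mgf_fps \<mu> - fps_X * fps_deriv (mgf_fps \<mu>)) $ j =
     (real (j * (j - 1)) * (\<integral>x. x ^ (j - 2) \<partial>\<mu>) - real j * (\<integral>x. x ^ j \<partial>\<mu>)) / fact j"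
proof -
  consider "j = 0" | "j = 1" | i where "j = Suc (Suc i)"
    by (metis One_nat_def not0_implies_Suc)
  then show ?thesis
  proof cases
    case 3
    define P where "P = real (j * (j - 1))"
    have "P \<noteq> 0"
      unfolding P_def of_nat_eq_0_iff 3 by simp
    moreover have "fact j = P * fact i"
      unfolding P_def 3 by (simp add: algebra_simps)
    ultimately have "P * a / fact j = a / fact i" for a
      by simp
    then have "(P * a - b) / fact j = a / fact i - b / fact j" for a b
      by (simp only: diff_divide_distrib)
    then show ?thesis
      unfolding P_def 3 by (simp add: fps_X_power_mult_nth del: of_nat_mult fact_Suc)
  qed (auto simp: fps_X_power_mult_nth)
qed

text \<open>Invariance gives \<open>t^2 A - t A' = 0\<close>, and \<open>t\<close> cancels; this is
  the equation of \<open>exp (t^2 / 2)\<close>.\<close>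

lemma fps_deriv_mgf_fps_std_normal:
  "fps_deriv (mgf_fps std_normal_distribution) = fps_X * mgf_fps std_normal_distribution"
proof -
  have "fps_X ^ 2 * mgf_fps std_normal_distribution
      - fps_X * fps_deriv (mgf_fps std_normal_distribution) = 0"
    by (rule fps_ext) (simp only: mgf_fps_ornstein_uhlenbeck_nth std_normal_moment_rec, simp)
  then have "fps_X * fps_deriv (mgf_fps std_normal_distribution) =
      fps_X * (fps_X * mgf_fps std_normal_distribution)"
    by (simp add: power2_eq_square mult.assoc)
  then show ?thesis by simp
qed

section \<open>Intertwining kernels\<close>

lemma monomial_eq_sum:
  "(\<lambda>x::real. x ^ j) = (\<lambda>x. \<Sum>i\<le>j. (if i = j then 1 else 0) * x ^ i)"
  by (auto simp: if_distrib[of "\<lambda>a. a * _"] cong: if_cong)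

lemma monomial_polynomial_function: "(\<lambda>x::real. x ^ j) \<in> polynomial_functions"
  unfolding polynomial_functions_def mem_Collect_eq real_polynomial_function_iff_sum
  by (intro exI) (rule monomial_eq_sum)

lemma intertwining_mgf_fps:
  assumes "\<Lambda> \<in> markov_kernels N" "intertwining N \<Lambda>" "n \<le> N"
  shows "ehrenfest_op N (\<lambda>n. mgf_fps (\<Lambda> n) $ j) n =
    (fps_X ^ 2 * mgf_fps (\<Lambda> n) - fps_X * fps_deriv (mgf_fps (\<Lambda> n))) $ j"
proof -
  have \<Lambda>: "\<Lambda> n \<in> gauss_integrating_measures"
    using assms by (auto simp: markov_kernels_def)
  have "ehrenfest_op N (kernel_op \<Lambda> (\<lambda>x. x ^ j)) n =
      kernel_op \<Lambda> (ornstein_uhlenbeck (\<lambda>x. x ^ j)) n"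
    using assms monomial_polynomial_function by (auto simp: intertwining_def)
  also have "\<dots> = real (j * (j - 1)) * (\<integral>x. x ^ (j - 2) \<partial>\<Lambda> n) - real j * (\<integral>x. x ^ j \<partial>\<Lambda> n)"
    unfolding kernel_op_def monomial_eq_sum[of j]
    unfolding integral_ornstein_uhlenbeck_poly[OF \<Lambda>]
    by (simp add: if_distrib[of "\<lambda>a. a * _"] cong: if_cong)
  finally have "ehrenfest_op N (kernel_op \<Lambda> (\<lambda>x. x ^ j)) n = \<dots>" .
  moreover have "ehrenfest_op N (\<lambda>n. mgf_fps (\<Lambda> n) $ j) n =
      ehrenfest_op N (kernel_op \<Lambda> (\<lambda>x. x ^ j)) n / fact j"
    by (simp add: ehrenfest_op_def kernel_op_def sum_divide_distrib)
  ultimately show ?thesis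
    unfolding mgf_fps_ornstein_uhlenbeck_nth by simp
qed

text \<open>As \<open>exp (x t - t^2 / 2)\<close> generates the Hermite polynomials
  \<open>He_k\<close>, the \<open>k\<close>-th coefficient is the integral of
  \<open>He_k / k!\<close>.\<close>

definition hermite_fps :: "real measure \<Rightarrow> real fps" where
  "hermite_fps \<mu> = inverse (mgf_fps std_normal_distribution) * mgf_fps \<mu>"

lemma mgf_fps_0:
  assumes "\<mu> \<in> gauss_integrating_measures"
  shows "mgf_fps \<mu> $ 0 = 1"
proof -
  interpret real_distribution \<mu>
    using assms by (simp add: gauss_integrating_measures_def)
  show ?thesis using prob_space by simp
qed

lemma mgf_fps_std_normal_inverse:
  "inverse (mgf_fps std_normal_distribution) * mgf_fps std_normal_distribution = 1"
  using mgf_fps_0[OF std_normal_gauss_integrating]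
  by (intro inverse_mult_eq_1) (metis zero_neq_one)

lemma mgf_fps_hermite_fps:
  "mgf_fps \<mu> = mgf_fps std_normal_distribution * hermite_fps \<mu>"
  using mgf_fps_std_normal_inverse unfolding hermite_fps_def
  by (metis mult.assoc mult.commute mult_1)

lemma hermite_fps_0:
  assumes "\<mu> \<in> gauss_integrating_measures"
  shows "hermite_fps \<mu> $ 0 = 1"
  unfolding hermite_fps_def fps_mult_nth_0 fps_inverse_nth_0
  by (simp only: mgf_fps_0[OF std_normal_gauss_integrating] mgf_fps_0[OF assms]) simp

text \<open>The generator acts on \<open>n\<close> and commutes with multiplication by the fixed
  series \<open>inverse ?A\<close>. By the product rule and \<open>A' = t A\<close>, the terms
  \<open>t^2 A G\<close> cancel.\<close>

lemma hermite_fps_eigen: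
  assumes "\<Lambda> \<in> markov_kernels N" "intertwining N \<Lambda>" "n \<le> N"
  shows "ehrenfest_op N (\<lambda>n. hermite_fps (\<Lambda> n) $ k) n = - real k * hermite_fps (\<Lambda> n) $ k"
proof -
  let ?A = "mgf_fps std_normal_distribution" and ?M = "mgf_fps (\<Lambda> n)" and ?G = "hermite_fps (\<Lambda> n)"
  have "ehrenfest_op N (\<lambda>n. hermite_fps (\<Lambda> n) $ k) n =
      (\<Sum>i=0..k. inverse ?A $ i * ehrenfest_op N (\<lambda>n. mgf_fps (\<Lambda> n) $ (k - i)) n)"
    unfolding hermite_fps_def fps_mult_nth by (rule ehrenfest_op_sum)
  also have "\<dots> = (inverse ?A * (fps_X ^ 2 * ?M - fps_X * fps_deriv ?M)) $ k"
    unfolding fps_mult_nth[of "inverse ?A"] intertwining_mgf_fps[OF assms] ..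
  also have "fps_X ^ 2 * ?M - fps_X * fps_deriv ?M = - fps_X * (?A * fps_deriv ?G)"
    unfolding mgf_fps_hermite_fps[of "\<Lambda> n"] fps_deriv_mult fps_deriv_mgf_fps_std_normal
    by (simp add: algebra_simps power2_eq_square)
  also have "inverse ?A * (- fps_X * (?A * fps_deriv ?G)) = - fps_X * fps_deriv ?G"
    using mgf_fps_std_normal_inverse by algebra
  also have "(- fps_X * fps_deriv ?G) $ k = - real k * ?G $ k"
    by (cases k) (auto simp: algebra_simps)
  finally show ?thesis .
qed

lemma eval_mgf_fps_std_normal_pos: "eval_fps (mgf_fps std_normal_distribution) t > 0"
proof -
  note \<gamma> = std_normal_gauss_integrating
  interpret real_distribution std_normal_distribution
    by (rule real_dist_normal_dist)
  have int: "integrable std_normal_distribution (\<lambda>x. x)"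
    using gauss_integrating_moment[OF \<gamma>, of 1] by simp
  \<comment> \<open>The Gaussian has mean zero, so \<open>1 + x * t \<le> exp (x * t)\<close> even
    bounds the transform below by 1.\<close>
  have "1 = (\<integral>x. 1 + x * t \<partial>std_normal_distribution)"
    using int prob_space integral_std_normal_distribution_moment_odd[of 1] by simp
  also have "\<dots> \<le> (\<integral>x. exp (x * t) \<partial>std_normal_distribution)"
    using int gauss_integrating_mgf_sums(1)[OF \<gamma>, of t]
    by (intro integral_mono) auto
  finally show ?thesis
    unfolding eval_mgf_fps[OF \<gamma>] by simp
qed

lemma hermite_fps_top_nonneg:
  assumes \<mu>: "\<mu> \<in> gauss_integrating_measures" and k: "k \<ge> 1"
    and top: "\<And>j. j > k \<Longrightarrow> hermite_fps \<mu> $ j = 0"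
  shows "hermite_fps \<mu> $ k \<ge> 0"
proof (rule ccontr)
  assume neg: "\<not> hermite_fps \<mu> $ k \<ge> 0"
  \<comment> \<open>The sign is reversed so that \<open>p\<close> has positive leading coefficient
    and is eventually positive.\<close>
  define p where "p = (\<Sum>j\<le>k. monom (- (hermite_fps \<mu> $ j)) j)"
  have p: "coeff p j = - (hermite_fps \<mu> $ j)" for j
    using top[of j] by (auto simp: p_def coeff_sum not_le)
  have "degree p = k"
    using neg top by (intro antisym degree_le le_degree) (auto simp: p)
  then have "lead_coeff p > 0" using neg by (simp add: p)
  then obtain t where t: "poly p t > 0"
    using poly_pinfty_gt_lc[of p] by (meson less_le_trans order_refl)
  have "hermite_fps \<mu> = fps_of_poly (- p)"
    by (rule fps_ext) (simp add: p)
  then have "(\<integral>x. exp (x * t) \<partial>\<mu>) = eval_fps (mgf_fps std_normal_distribution) t * - poly p t"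
    unfolding eval_mgf_fps[OF \<mu>, symmetric] mgf_fps_hermite_fps[of \<mu>]
    by (subst eval_fps_mult) (simp_all only: fps_conv_radius_mgf_fps[OF std_normal_gauss_integrating]
        eval_fps_of_poly fps_conv_radius_fps_of_poly, simp_all)
  moreover have "(\<integral>x. exp (x * t) \<partial>\<mu>) \<ge> 0"
    by simp
  ultimately show False
    using mult_pos_pos[OF eval_mgf_fps_std_normal_pos[of t] t] by linarith
qed

lemma intertwining_hermite_fps:
  assumes kern: "\<Lambda> \<in> markov_kernels N" "intertwining N \<Lambda>" and n: "n \<le> N"
  shows "hermite_fps (\<Lambda> n) = 1"
proof -
  have \<Lambda>: "\<Lambda> n \<in> gauss_integrating_measures" if "n \<le> N" for n
    using kern that by (auto simp: markov_kernels_def)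
  have eig: "\<forall>n\<le>N. ehrenfest_op N (\<lambda>n. hermite_fps (\<Lambda> n) $ k) n =
      - real k * hermite_fps (\<Lambda> n) $ k" for k
    using hermite_fps_eigen[OF kern] by blast
  \<comment> \<open>Index 0 is left out, its coefficient being always 1. All \<open>n\<close> are
    taken together, since the negative value may occur at another \<open>n\<close> than the nonzero
    one.\<close>
  define K where "K = {k. k \<ge> 1 \<and> (\<exists>n\<le>N. hermite_fps (\<Lambda> n) $ k \<noteq> 0)}"
  have "K \<subseteq> {..N}"
  proof
    fix k assume "k \<in> K"
    then obtain m where "m \<le> N" "hermite_fps (\<Lambda> m) $ k \<noteq> 0"
      by (auto simp: K_def)
    from ehrenfest_eigenvalue_bound[OF eig this]
    show "k \<in> {..N}" by simp
  qed
  then have fin: "finite K" by (rule finite_subset) simp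
  have "K = {}"
  proof (rule ccontr)
    assume "K \<noteq> {}"
    define k where "k = Max K"
    have "k \<in> K" using \<open>K \<noteq> {}\<close> fin by (simp add: k_def)
    then obtain m where k: "k \<ge> 1" and m: "m \<le> N" "hermite_fps (\<Lambda> m) $ k \<noteq> 0"
      by (auto simp: K_def)
    have "- real k \<noteq> 0" using k by simp
    from ehrenfest_eigenfunction_neg[OF eig this m]
    obtain l where l: "l \<le> N" "hermite_fps (\<Lambda> l) $ k < 0" by blast
    have "hermite_fps (\<Lambda> l) $ j = 0" if "j > k" for j
    proof (rule ccontr)
      assume "hermite_fps (\<Lambda> l) $ j \<noteq> 0"
      then have "j \<in> K" using l k that by (auto simp: K_def)
      then have "j \<le> k" using fin by (simp add: k_def)
      with that show False by simp
    qed
    from hermite_fps_top_nonneg[OF \<Lambda>[OF l(1)] k this] l(2) show False by simp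
  qed
  show ?thesis
  proof (rule fps_ext)
    fix j
    show "hermite_fps (\<Lambda> n) $ j = 1 $ j"
      using \<open>K = {}\<close> n hermite_fps_0[OF \<Lambda>[OF n]] by (cases j) (auto simp: K_def)
  qed
qed

theorem proposition4:
  fixes N :: nat and \<Lambda> :: "nat \<Rightarrow> real measure"
  shows "\<Lambda> \<in> markov_kernels N \<and> intertwining N \<Lambda> \<longleftrightarrow>
         (\<forall>n\<in>{0..N}. \<Lambda> n = std_normal_distribution)"
proof (intro iffI ballI conjI)
  fix n assume kern: "\<Lambda> \<in> markov_kernels N \<and> intertwining N \<Lambda>" and n: "n \<in> {0..N}"
  then have "\<Lambda> n \<in> gauss_integrating_measures"
    by (auto simp: markov_kernels_def)
  moreover have "mgf_fps (\<Lambda> n) = mgf_fps std_normal_distribution"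
    using intertwining_hermite_fps[of \<Lambda> N n] kern n mgf_fps_hermite_fps[of "\<Lambda> n"] by simp
  then have "(\<integral>x. x ^ j \<partial>\<Lambda> n) = (\<integral>x. x ^ j \<partial>std_normal_distribution)" for j
    using mgf_fps_nth[of "\<Lambda> n" j] mgf_fps_nth[of std_normal_distribution j] by simp
  ultimately show "\<Lambda> n = std_normal_distribution"
    using gauss_integrating_eqI std_normal_gauss_integrating by blast
next
  assume \<Lambda>: "\<forall>n\<in>{0..N}. \<Lambda> n = std_normal_distribution"
  have "prob_space std_normal_distribution"
    by (rule prob_space_normal_density) simp
  then have "\<Lambda> \<in> count_space {0..N} \<rightarrow>\<^sub>M prob_algebra borel"
    using \<Lambda> by (simp add: space_prob_algebra)
  then show "\<Lambda> \<in> markov_kernels N"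
    using \<Lambda> std_normal_gauss_integrating by (simp add: markov_kernels_def)
  show "intertwining N \<Lambda>"
    unfolding intertwining_def
  proof (intro ballI)
    fix f n assume f: "f \<in> polynomial_functions" and n: "n \<in> {0..N}"
    obtain a d where fa: "f = (\<lambda>x. \<Sum>i\<le>d. a i * x ^ i)"
      using f by (auto simp: polynomial_functions_def real_polynomial_function_iff_sum)
    \<comment> \<open>Both sides vanish: the Gaussian is invariant, and
      \<open>kernel_op \<Lambda> f\<close> is constant on \<open>{0..N}\<close>.\<close>
    have "kernel_op \<Lambda> (ornstein_uhlenbeck f) n = 0"
      using \<Lambda> n unfolding kernel_op_def fa
      by (simp only: integral_ornstein_uhlenbeck_poly[OF std_normal_gauss_integrating]
          std_normal_moment_rec) simp
    moreover have "ehrenfest_op N (kernel_op \<Lambda> f) n = 0"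
      using \<Lambda> n by (intro ehrenfest_op_const[where c = "\<integral>x. f x \<partial>std_normal_distribution"])
        (auto simp: kernel_op_def)
    ultimately show "ehrenfest_op N (kernel_op \<Lambda> f) n = kernel_op \<Lambda> (ornstein_uhlenbeck f) n"
      by simp
  qed
qed

end
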